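(* Let $X$ be a set, $f:X\to X$ a self-map, and equip $X$ with the primal topology $\tau_f$ induced by $f$. Then the set of non-wandering points of $f$ is $$\Omega(f)=\bigcap\{f^k(X): k\in\mathbb{N}\}.$$
   Context: $\mathbb{N}$ is the set of non-negative integers and $\mathbb{Z}^+$ the set of positive integers. The primal topology induced by $f$ on $X$ is $\tau_f=\{A\subseteq X: f^{-1}(A)\subseteq A\}$. A point $x$ is a wandering point of $f$ if there exist a neighborhood $U$ of $x$ and $n\in\mathbb{Z}^+$ such that $U\cap f^k(U)=\emptyset$ for all $k\ge n$; otherwise $x$ is non-wandering. $\Omega(f)$ denotes the set of non-wandering points. *)

theory Defs
  imports "HOL-Analysis.Abstract_Topology"
begin

text \<open>A self-map of the set \<open>X\<close> is a function \<open>f \<in> X \<rightarrow> X\<close>; its preimage operator relative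
  to \<open>X\<close> is \<open>A \<mapsto> f -` A \<inter> X\<close>.\<close>

definition primal_topology :: "'a set \<Rightarrow> ('a \<Rightarrow> 'a) \<Rightarrow> 'a topology" where
  "primal_topology X f = topology (\<lambda>A. A \<subseteq> X \<and> f -` A \<inter> X \<subseteq> A)"

lemma istopology_primal: "istopology (\<lambda>A. A \<subseteq> X \<and> f -` A \<inter> X \<subseteq> A)"
  unfolding istopology_def by blast

lemma openin_primal_topology:
  "openin (primal_topology X f) A \<longleftrightarrow> A \<subseteq> X \<and> f -` A \<inter> X \<subseteq> A"
  by (simp add: primal_topology_def topology_inverse'[OF istopology_primal])

lemma topspace_primal_topology [simp]: "topspace (primal_topology X f) = X"
  unfolding topspace_def openin_primal_topology by blast

text \<open>Neighborhoods are not required to be open.\<close>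

definition neighborhood_of :: "'a topology \<Rightarrow> 'a \<Rightarrow> 'a set \<Rightarrow> bool" where
  "neighborhood_of T x U \<longleftrightarrow> U \<subseteq> topspace T \<and> (\<exists>V. openin T V \<and> x \<in> V \<and> V \<subseteq> U)"

definition wandering_point :: "'a topology \<Rightarrow> ('a \<Rightarrow> 'a) \<Rightarrow> 'a \<Rightarrow> bool" where
  "wandering_point T f x \<longleftrightarrow>
     (\<exists>U. neighborhood_of T x U \<and> (\<exists>n\<ge>1. \<forall>k\<ge>n. U \<inter> (f ^^ k) ` U = {}))"

definition nonwandering_set :: "'a topology \<Rightarrow> ('a \<Rightarrow> 'a) \<Rightarrow> 'a set" where
  "nonwandering_set T f = {x \<in> topspace T. \<not> wandering_point T f x}"

end

(* Every neighborhood of x contains the backward orbit of x, which is itself open.  So x is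
   non-wandering iff the backward orbit meets its k-th forward image for arbitrarily large k,
   that is, iff x has k-th preimages for all k. *)
theory Submission
  imports Defs
begin

lemma funpow_in_invariant:
  assumes "f \<in> X \<rightarrow> X" "x \<in> X"
  shows "(f ^^ k) x \<in> X"
  using assms by (induction k) auto

text \<open>The first \<open>k - n\<close> of the \<open>k\<close> steps stay inside
  \<open>X\<close>, and the last \<open>n\<close> steps then start from a point of \<open>X\<close>.
  This turns preimages of arbitrarily large order into preimages of every order.\<close>

lemma funpow_image_antimono:
  assumes f: "f \<in> X \<rightarrow> X" and "n \<le> k"
  shows "(f ^^ k) ` X \<subseteq> (f ^^ n) ` X"
proof -
  have "f ^^ k = f ^^ n \<circ> f ^^ (k - n)"
    using \<open>n \<le> k\<close> by (metis funpow_add le_add_diff_inverse)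
  then show ?thesis
    using funpow_in_invariant[OF f] by auto
qed

text \<open>For a self-map \<open>f\<close> of \<open>X\<close> and \<open>x\<close> in
  \<open>X\<close>, this is the least open set containing \<open>x\<close>, hence the sharpest
  neighborhood to test for wandering.\<close>

definition backward_orbit :: "'a set \<Rightarrow> ('a \<Rightarrow> 'a) \<Rightarrow> 'a \<Rightarrow> 'a set" where
  "backward_orbit X f x = {y \<in> X. \<exists>n. (f ^^ n) y = x}"

text \<open>If \<open>f y\<close> reaches \<open>x\<close> in \<open>n\<close> steps, then
  \<open>y\<close> reaches it in \<open>n + 1\<close>.\<close>

lemma openin_backward_orbit: "openin (primal_topology X f) (backward_orbit X f x)"
proof -
  have "y \<in> backward_orbit X f x" if y: "y \<in> X" "f y \<in> backward_orbit X f x" for y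
  proof -
    obtain n where "(f ^^ n) (f y) = x"
      using y unfolding backward_orbit_def by blast
    then have "(f ^^ Suc n) y = x"
      by (simp add: funpow_swap1)
    with \<open>y \<in> X\<close> show ?thesis
      unfolding backward_orbit_def by blast
  qed
  then show ?thesis
    by (auto simp: openin_primal_topology backward_orbit_def)
qed

lemma neighborhood_of_backward_orbit:
  assumes "x \<in> X"
  shows "neighborhood_of (primal_topology X f) x (backward_orbit X f x)"
proof -
  have "x \<in> backward_orbit X f x"
    using assms unfolding backward_orbit_def by (auto intro: exI[of _ 0])
  then show ?thesis
    using openin_backward_orbit[of X f x]
    by (auto simp: neighborhood_of_def backward_orbit_def)
qed

text \<open>Openness pulls membership in \<open>V\<close> back by one step, but only for points of
  \<open>X\<close>. Since \<open>f\<close> keeps the orbit of \<open>y\<close> in \<open>X\<close>,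
  the step can be repeated from \<open>(f ^^ n) y\<close> down to \<open>y\<close>.\<close>

lemma primal_open_backward_closed:
  assumes f: "f \<in> X \<rightarrow> X" and V: "openin (primal_topology X f) V"
    and "y \<in> X" "(f ^^ n) y \<in> V"
  shows "y \<in> V"
  using assms(3,4)
proof (induction n arbitrary: y)
  case (Suc n)
  then have "f y \<in> V"
    using f by (auto simp: funpow_swap1)
  then show ?case
    using V Suc.prems by (auto simp: openin_primal_topology)
qed simp

theorem theorem7:
  fixes X :: "'a set" and f :: "'a \<Rightarrow> 'a"
  assumes "f \<in> X \<rightarrow> X"
  shows "nonwandering_set (primal_topology X f) f = (\<Inter>k::nat. (f ^^ k) ` X)"
proof (intro equalityI subsetI)
  fix x assume "x \<in> nonwandering_set (primal_topology X f) f"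
  then have x: "x \<in> X" and nonwandering: "\<not> wandering_point (primal_topology X f) f x"
    by (auto simp: nonwandering_set_def)
  have "x \<in> (f ^^ n) ` X" for n
  proof -
    let ?B = "backward_orbit X f x"
    \<comment> \<open>The threshold is \<open>Suc n\<close> rather than \<open>n\<close> because
      wandering is defined with thresholds of at least 1.\<close>
    obtain k where k: "k \<ge> Suc n" "?B \<inter> (f ^^ k) ` ?B \<noteq> {}"
      using nonwandering neighborhood_of_backward_orbit[OF x]
      unfolding wandering_point_def by (metis le_add1 plus_1_eq_Suc)
    \<comment> \<open>A common point has the form \<open>(f ^^ k) y\<close> with \<open>y\<close> in
      the backward orbit; lying there itself, it reaches \<open>x\<close> after \<open>m\<close>
      more steps.\<close>
    then obtain y m where y: "y \<in> X" and "(f ^^ m) ((f ^^ k) y) = x"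
      by (auto simp: backward_orbit_def)
    then have "(f ^^ (m + k)) y = x"
      by (simp add: funpow_add)
    with y have "x \<in> (f ^^ (m + k)) ` X"
      by blast
    moreover have "n \<le> m + k"
      using k(1) by simp
    ultimately show ?thesis
      using funpow_image_antimono[OF assms] by blast
  qed
  then show "x \<in> (\<Inter>k. (f ^^ k) ` X)"
    by blast
next
  fix x assume x: "x \<in> (\<Inter>k. (f ^^ k) ` X)"
  then have "x \<in> (f ^^ 0) ` X"
    by blast
  then have "x \<in> X"
    by simp
  \<comment> \<open>The common point is \<open>x\<close> itself: a \<open>k\<close>-th preimage of
    \<open>x\<close> in \<open>X\<close> lies in every open set around \<open>x\<close>. This works
    for every \<open>k\<close>, so no threshold can witness wandering.\<close>
  have "U \<inter> (f ^^ k) ` U \<noteq> {}"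
    if U: "neighborhood_of (primal_topology X f) x U" for U k
  proof -
    obtain V where V: "openin (primal_topology X f) V" "x \<in> V" "V \<subseteq> U"
      using U unfolding neighborhood_of_def by blast
    have "x \<in> (f ^^ k) ` X"
      using x by (rule INT_D) simp
    then obtain y where y: "y \<in> X" "(f ^^ k) y = x"
      by auto
    then have "y \<in> V"
      using primal_open_backward_closed[OF assms V(1), of y k] V(2) by simp
    then have "x \<in> U \<inter> (f ^^ k) ` U"
      using y V(2,3) by blast
    then show ?thesis
      by blast
  qed
  then have "\<not> wandering_point (primal_topology X f) f x"
    unfolding wandering_point_def by blast
  with \<open>x \<in> X\<close> show "x \<in> nonwandering_set (primal_topology X f) f"
    by (simp add: nonwandering_set_def)
qed

end
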